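(* Let $C>0$ and $A\ge 2$ be real numbers. There is a constant $K=K(A,C)$ such that the following holds for all real numbers $M$ and $N\ge 3$. Let $Z$ be the number of primes in $[M+1,M+N]$ and let $S(\beta)=\sum_{M+1\le p\le M+N}e(p\beta)$, the sum being over primes $p$. If $$Z\ge\frac{2N}{\log N+C\log\log N},$$ then $$\int_{-(\log N)^A/N}^{(\log N)^A/N}\biggl|S(\beta)-\frac{Z}{N}\sum_{M+1\le n\le M+N}e(n\beta)\biggr|^2d\beta\le K\,\frac{Z\log\log N}{(\log N)^2}.$$
   Context: $e(x)=\exp(2i\pi x)$. The inner sum over $n$ runs over integers. *)

theory Defs
  imports "HOL-Analysis.Analysis" "HOL-Computational_Algebra.Primes"
begin

definition e :: "real \<Rightarrow> complex" where
  "e x = exp (2 * \<i> * complex_of_real pi * complex_of_real x)"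

text \<open>\<open>M\<close> and \<open>N\<close> are arbitrary reals and \<open>M\<close> may be negative; the integers of the
  interval \<open>[M + 1, M + N]\<close> are therefore taken in \<^typ>\<open>int\<close>, whereas the primes are the
  usual positive ones.\<close>

definition primes_between :: "real \<Rightarrow> real \<Rightarrow> nat set" where
  "primes_between M N = {p. prime p \<and> M + 1 \<le> real p \<and> real p \<le> M + N}"

definition ints_between :: "real \<Rightarrow> real \<Rightarrow> int set" where
  "ints_between M N = {n. M + 1 \<le> real_of_int n \<and> real_of_int n \<le> M + N}"

definition Z :: "real \<Rightarrow> real \<Rightarrow> nat" where
  "Z M N = card (primes_between M N)"

definition S :: "real \<Rightarrow> real \<Rightarrow> real \<Rightarrow> complex" where
  "S M N \<beta> = (\<Sum>p\<in>primes_between M N. e (real p * \<beta>))"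

lemma finite_primes_between [simp]: "finite (primes_between M N)"
proof (rule finite_subset)
  show "primes_between M N \<subseteq> {..nat \<lfloor>M + N\<rfloor>}"
    by (auto simp: primes_between_def le_nat_floor)
qed simp

lemma finite_ints_between [simp]: "finite (ints_between M N)"
proof (rule finite_subset)
  show "ints_between M N \<subseteq> {\<lceil>M + 1\<rceil>..\<lfloor>M + N\<rfloor>}"
    unfolding ints_between_def by (auto simp del: ceiling_add_one) linarith+
qed simp

end

theory Submission
  imports Defs "HOL-Number_Theory.Totient" "HOL-Computational_Algebra.Squarefree"
    "HOL-Real_Asymp.Real_Asymp"
begin

text \<open>
  A prime larger than \<open>Q\<close> is coprime to every modulus \<open>q \<le> Q\<close>, and Ramanujan sums of squarefree
  modulus are \<open>\<plusminus>1\<close> on integers coprime to \<open>q\<close>. Cauchy--Schwarz then bounds \<open>|S(\<beta>)|\<^sup>2 / \<phi>(q)\<close> by the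
  sum of \<open>|S(\<beta> + a/q)|\<^sup>2\<close> over the reduced residues \<open>a\<close>. Choosing \<open>Q\<close> a small multiple of \<open>1 / sqrt d\<close> with
  \<open>d = (log N)\<^sup>A / N\<close>, the arcs of radius \<open>d\<close> around the Farey fractions are disjoint, so the integral
  of \<open>|S|\<^sup>2\<close> over \<open>[-d, d]\<close> is at most \<open>Z / \<Sum> 1/\<phi>(q) \<le> Z / log Q\<close>, which is about \<open>2 Z / log N\<close>. Expanding the
  square, the cross term contributes \<open>-2 Z\<^sup>2/N\<close> up to a small tail and the last term at most \<open>Z\<^sup>2/N\<close>;
  the hypothesis on \<open>Z\<close> says precisely that \<open>Z\<^sup>2/N\<close> cancels \<open>2 Z / log N\<close> to within the claimed error.
  Since the integral increases with \<open>A\<close>, one may take \<open>A \<ge> 4\<close>, and then the trivial estimate of the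
  tail suffices.
\<close>

section \<open>Ramanujan sums and the sum of reciprocals of the totient\<close>

lemma e_0 [simp]: "e 0 = 1"
  by (simp add: e_def)

lemma e_add: "e (x + y) = e x * e y"
  by (simp add: e_def ring_distribs exp_add)

lemma e_eq_cis: "e x = cis (2 * pi * x)"
  by (simp add: e_def cis_conv_exp mult_ac)

lemma norm_e [simp]: "cmod (e x) = 1"
  by (simp add: e_eq_cis)

lemma cnj_e: "cnj (e x) = e (- x)"
  by (simp add: e_eq_cis cis_cnj)

lemma e_power: "e x ^ n = e (real n * x)"
  by (induction n) (simp_all add: e_add ring_distribs)

lemma e_of_int [simp]: "e (real_of_int n) = 1"
  by (simp add: e_def exp_eq_1 mult_ac)

lemma e_eq_1_iff: "e x = 1 \<longleftrightarrow> x \<in> \<int>"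
proof
  assume "e x = 1"
  then obtain n :: int where "2 * pi * x = real_of_int (2 * n) * pi"
    unfolding e_def exp_eq_1 by auto
  then have "x = real_of_int n"
    by (simp add: mult_ac)
  then show "x \<in> \<int>"
    by simp
qed (auto elim: Ints_cases)

text \<open>The terms are successive powers of a p-th root of unity, which differs from 1 because p
  does not divide n; the geometric sum then vanishes.\<close>

lemma sum_e_prime_eq_0:
  assumes "prime p" "\<not> int p dvd n"
  shows "(\<Sum>j<p. e (real j * real_of_int n / real p)) = 0"
proof -
  define w where "w = e (real_of_int n / real p)"
  have p: "p > 0"
    using assms(1) by (simp add: prime_gt_0_nat)
  have "w \<noteq> 1"
  proof
    assume "w = 1"
    then obtain k where "real_of_int n / real p = real_of_int k"
      unfolding w_def e_eq_1_iff by (auto elim: Ints_cases)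
    then have "real_of_int n = real_of_int (k * int p)"
      using p by (simp add: field_simps)
    then have "n = k * int p"
      by (simp only: of_int_eq_iff)
    with assms(2) show False
      by simp
  qed
  moreover have "w ^ p = 1"
    using p by (simp add: w_def e_power)
  moreover have "(\<Sum>j<p. e (real j * real_of_int n / real p)) = (\<Sum>j<p. w ^ j)"
    by (simp add: w_def e_power)
  ultimately show ?thesis
    by (simp add: sum_gp_strict)
qed

section \<open>Ramanujan sums of squarefree modulus\<close>

definition ramanujan_sum :: "nat \<Rightarrow> int \<Rightarrow> complex" where
  "ramanujan_sum q n = (\<Sum>a\<in>totatives q. e (real a * real_of_int n / real q))"

text \<open>The sum over all \<open>a \<le> p * m\<close> coprime to \<open>m\<close> alone vanishes; the multiples of \<open>p\<close> among
  these \<open>a\<close> account for \<^term>\<open>ramanujan_sum m n\<close>.\<close>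
lemma ramanujan_sum_prime_mult:
  assumes p: "prime p" and pm: "\<not> p dvd m" and m: "m > 0" and pn: "\<not> int p dvd n"
  shows "ramanujan_sum (p * m) n = - ramanujan_sum m n"
proof -
  define f where "f = (\<lambda>a. e (real a * real_of_int n / real (p * m)))"
  define B where "B = {a \<in> {0<..p * m}. coprime a m}"
  have p0: "p > 0"
    using p by (simp add: prime_gt_0_nat)
  have gcd_shift: "gcd (a + j * m) m = gcd a m" for a j
    by (metis add.commute gcd.commute gcd_add_mult)
  \<comment> \<open>Each b up to p * m is uniquely a + j * m with a in 1..m and j < p, and
    coprimality to m depends on a alone. The inner sum over j is then a full sum over residues mod
    p.\<close>
  have bij: "bij_betw (\<lambda>(a, j). a + j * m) (totatives m \<times> {..<p}) B"
    unfolding bij_betw_def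
  proof
    show "inj_on (\<lambda>(a, j). a + j * m) (totatives m \<times> {..<p})"
    proof (rule inj_onI, clarify)
      fix a j a' j'
      assume a: "a \<in> totatives m" "a' \<in> totatives m" and eq: "a + j * m = a' + j' * m"
      have "a - 1 < m" "a' - 1 < m" "a \<ge> 1" "a' \<ge> 1"
        using a by (auto simp: in_totatives_iff)
      moreover from this eq have "(a - 1) + j * m = (a' - 1) + j' * m"
        by linarith
      then have "((a - 1) + j * m) div m = ((a' - 1) + j' * m) div m"
        by simp
      moreover have "(x + i * m) div m = i" if "x < m" for x i
        using that m by simp
      ultimately have "j = j'"
        by metis
      with eq show "a = a' \<and> j = j'"
        by simp
    qed
    show "(\<lambda>(a, j). a + j * m) ` (totatives m \<times> {..<p}) = B"
    proof (intro equalityI subsetI)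
      fix b assume "b \<in> (\<lambda>(a, j). a + j * m) ` (totatives m \<times> {..<p})"
      then obtain a j where aj: "b = a + j * m" "a \<in> totatives m" "j < p"
        by auto
      have "a + j * m \<le> m + j * m"
        using aj by (auto simp: in_totatives_iff)
      also have "\<dots> = Suc j * m"
        by simp
      also have "\<dots> \<le> p * m"
        using aj by (intro mult_right_mono) auto
      finally show "b \<in> B"
        using aj by (auto simp: B_def in_totatives_iff coprime_iff_gcd_eq_1 gcd_shift)
    next
      fix b assume b: "b \<in> B"
      \<comment> \<open>Totatives of m lie in 1..m rather than 0..m-1, so b - 1 is divided and the
        remainder is shifted back by 1.\<close>
      define j a where "j = (b - 1) div m" and "a = (b - 1) mod m + 1"
      have b0: "b \<ge> 1" "b \<le> p * m" "coprime b m"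
        using b by (auto simp: B_def)
      have eq: "b = a + j * m"
        using b0(1) div_mult_mod_eq[of "b - 1" m] unfolding j_def a_def by linarith
      have "b - 1 < p * m"
        using b0 by linarith
      then have "j < p"
        unfolding j_def by (rule less_mult_imp_div_less)
      moreover have "a \<in> totatives m"
      proof -
        have "gcd a m = 1"
          using b0(3) eq gcd_shift[of a j] by (simp add: coprime_iff_gcd_eq_1)
        moreover have "0 < a" "a \<le> m"
          using mod_less_divisor[OF m, of "b - 1"] by (auto simp: a_def)
        ultimately show ?thesis
          by (simp add: in_totatives_iff coprime_iff_gcd_eq_1)
      qed
      ultimately show "b \<in> (\<lambda>(a, j). a + j * m) ` (totatives m \<times> {..<p})"
        using eq by (intro image_eqI[of _ _ "(a, j)"]) auto
    qed
  qed
  have "sum f B = (\<Sum>(a, j)\<in>totatives m \<times> {..<p}. f (a + j * m))"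
    using sum.reindex_bij_betw[OF bij, of f] by (simp add: case_prod_unfold)
  also have "\<dots> = (\<Sum>(a, j)\<in>totatives m \<times> {..<p}. f a * e (real j * real_of_int n / real p))"
    using m p0 by (intro sum.cong) (auto simp: f_def add_divide_distrib ring_distribs simp flip: e_add)
  also have "\<dots> = (\<Sum>a\<in>totatives m. f a * (\<Sum>j<p. e (real j * real_of_int n / real p)))"
    by (simp add: sum.cartesian_product sum_distrib_left)
  finally have 1: "sum f B = 0"
    by (simp add: sum_e_prime_eq_0[OF p pn])
  \<comment> \<open>For the prime p, not being coprime means being a multiple; and p * c is coprime
    to m exactly when c is.\<close>
  have split: "B = totatives (p * m) \<union> (*) p ` totatives m"
  proof (intro equalityI subsetI)
    fix b assume b: "b \<in> B"
    show "b \<in> totatives (p * m) \<union> (*) p ` totatives m"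
    proof (cases "p dvd b")
      case True
      then obtain c where "b = p * c" ..
      then show ?thesis
        using b p0 by (auto simp: B_def in_totatives_iff)
    next
      case False
      then have "coprime b p"
        using p by (subst coprime_commute) (rule prime_imp_coprime)
      then show ?thesis
        using b by (auto simp: B_def in_totatives_iff)
    qed
  next
    fix b assume "b \<in> totatives (p * m) \<union> (*) p ` totatives m"
    moreover have "coprime p m"
      using p pm by (simp add: prime_imp_coprime)
    ultimately show "b \<in> B"
      using p0 by (auto simp: B_def in_totatives_iff)
  qed
  have disj: "totatives (p * m) \<inter> (*) p ` totatives m = {}"
    using p not_prime_1 by (auto simp: in_totatives_iff)
  have "sum f B = sum f (totatives (p * m)) + sum f ((*) p ` totatives m)"
    unfolding split by (rule sum.union_disjoint) (use disj in auto)
  also have "sum f ((*) p ` totatives m) = ramanujan_sum m n"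
    using p0 by (subst sum.reindex) (auto simp: inj_on_def ramanujan_sum_def f_def)
  also have "sum f (totatives (p * m)) = ramanujan_sum (p * m) n"
    by (simp add: f_def ramanujan_sum_def)
  finally show ?thesis
    using 1 by (simp add: eq_neg_iff_add_eq_0)
qed

text \<open>Splitting off one prime at a time flips the sign each time, down to modulus 1 where the
  sum is 1. The value is the Moebius function of q, but what matters later is only that s has
  modulus 1 and is chosen before n.\<close>

lemma ramanujan_sum_squarefree:
  assumes "squarefree q"
  shows "\<exists>s \<in> {1, -1}. \<forall>n. coprime n (int q) \<longrightarrow> ramanujan_sum q n = s"
  using assms
proof (induction q rule: less_induct)
  case (less q)
  show ?case
  proof (cases "q = 1")
    case True
    then show ?thesis
      by (auto simp: ramanujan_sum_def)
  next
    case False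
    then obtain p where p: "prime p" "p dvd q"
      using prime_factor_nat by blast
    then obtain m where q: "q = p * m"
      by blast
    have q0: "q \<noteq> 0"
      using less.prems not_squarefree_0 by metis
    have m: "m > 0" "m < q"
      using q q0 p(1) prime_gt_1_nat[of p] by auto
    have pm: "\<not> p dvd m"
    proof
      assume "p dvd m"
      then have "p ^ 2 dvd q"
        unfolding q power2_eq_square by (rule mult_dvd_mono[OF dvd_refl])
      with less.prems p(1) show False
        by (auto simp: squarefree_def)
    qed
    have "squarefree m"
      using less.prems unfolding q by (rule squarefree_multD)
    from less.IH[OF m(2) this] obtain s
      where s: "s \<in> {1, -1}" "\<And>n. coprime n (int m) \<Longrightarrow> ramanujan_sum m n = s"
      by blast
    have "ramanujan_sum q n = - s" if "coprime n (int q)" for n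
    proof -
      have c: "coprime n (int p)" "coprime n (int m)"
        using that by (auto simp: q)
      have "\<not> int p dvd n"
      proof
        assume "int p dvd n"
        with c(1) have "is_unit (int p)"
          by (rule coprime_common_divisor) simp
        with p(1) show False
          by simp
      qed
      then show ?thesis
        unfolding q using ramanujan_sum_prime_mult[OF p(1) pm m(1)] s(2)[OF c(2)] by simp
    qed
    with s(1) show ?thesis
      by (intro bexI[of _ "- s"]) auto
  qed
qed

section \<open>A lower bound for the sum of reciprocals of the totient\<close>

lemma sum_geometric_prime_le:
  assumes "prime p"
  shows "(\<Sum>k=1..L. 1 / real p ^ k) \<le> 1 / (real p - 1)"
proof -
  have p: "real p > 1"
    using assms prime_gt_1_nat by simp
  have "(\<Sum>k=1..L. 1 / real p ^ k) = (1 - 1 / real p ^ L) / (real p - 1)"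
  proof (induction L)
    case (Suc L)
    define x where "x = 1 / real p ^ L"
    have "(1 - x / real p) / (real p - 1) = (1 - x) / (real p - 1) + x / real p"
      using p by (simp add: field_simps)
    then have "(1 - 1 / real p ^ Suc L) / (real p - 1)
        = (1 - 1 / real p ^ L) / (real p - 1) + 1 / real p ^ Suc L"
      by (simp add: x_def mult.commute)
    with Suc show ?case
      by simp
  qed simp
  also have "\<dots> \<le> 1 / (real p - 1)"
    using p by (intro divide_right_mono) auto
  finally show ?thesis .
qed

text \<open>A finite piece of an Euler product: the factor at p is the geometric series 1/p + 1/p^2
  + ..., with sum 1/(p - 1). It starts at exponent 1 because every n in F is divisible by each p in
  P. Allowing an arbitrary finite F avoids infinite sums and lets the induction pass to the p-free
  parts.\<close>

lemma sum_inverse_prime_factors_le: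
  assumes "finite P" "finite F" "\<forall>p\<in>P. prime p" "\<forall>n\<in>F. n > 0 \<and> prime_factors n = P"
  shows "(\<Sum>n\<in>F. 1 / real n) \<le> (\<Prod>p\<in>P. 1 / (real p - 1))"
  using assms
proof (induction P arbitrary: F rule: finite_induct)
  case empty
  have "F \<subseteq> {1}"
    using empty(3) by (auto simp: prime_factorization_empty_iff)
  then have "(\<Sum>n\<in>F. 1 / real n) \<le> (\<Sum>n\<in>{1}. 1 / real n)"
    by (intro sum_mono2) auto
  then show ?case
    by simp
next
  case (insert p P)
  define g where "g = (\<lambda>n. (multiplicity p n, n div p ^ multiplicity p n))"
  define F' where "F' = (snd \<circ> g) ` F"
  \<comment> \<open>The largest exponent of p that occurs; inserting 0 keeps \<open>Max\<close>
    meaningful when F is empty.\<close>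
  define L where "L = Max (insert 0 ((fst \<circ> g) ` F))"
  have p: "prime p" "real p > 1"
    using insert.prems prime_gt_1_nat by auto
  have dec: "n = p ^ fst (g n) * snd (g n)" for n
    by (simp add: g_def multiplicity_dvd)
  have inj: "inj_on g F"
    by (rule inj_onI) (metis dec)
  have gF: "g ` F \<subseteq> {1..L} \<times> F'"
  proof clarify
    fix k m n assume n: "n \<in> F" and kl: "(k, m) = g n"
    have "p \<in> prime_factors n"
      using insert.prems n by simp
    then have "k \<ge> 1"
      using kl by (auto simp: g_def prime_factors_multiplicity)
    moreover have "k \<le> L"
    proof -
      have "k = (fst \<circ> g) n"
        using kl by (metis comp_apply fst_conv)
      then show ?thesis
        using n insert.prems(1) unfolding L_def by (intro Max_ge) auto
    qed
    moreover have "m \<in> F'"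
    proof -
      have "m = (snd \<circ> g) n"
        using kl by (metis comp_apply snd_conv)
      then show ?thesis
        using n unfolding F'_def by blast
    qed
    ultimately show "k \<in> {1..L} \<and> m \<in> F'"
      by simp
  qed
  have F': "\<forall>m\<in>F'. m > 0 \<and> prime_factors m = P"
  proof
    fix m assume "m \<in> F'"
    then obtain n where n: "n \<in> F" "m = n div p ^ multiplicity p n"
      by (auto simp: F'_def g_def)
    have n0: "n > 0" "prime_factors n = insert p P"
      using insert.prems n by auto
    have nm: "n = p ^ multiplicity p n * m"
      using n by (simp add: multiplicity_dvd)
    then have m0: "m > 0"
      using n0(1) by (metis gr0I mult_0_right)
    have "\<not> p dvd m"
      unfolding n(2) using n0(1) p(1) by (intro multiplicity_decompose) auto
    have "p \<in> prime_factors n"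
      using n0 by simp
    then have k: "multiplicity p n > 0"
      by (simp add: prime_factors_multiplicity)
    have "prime_factors n = prime_factors (p ^ multiplicity p n) \<union> prime_factors m"
      using m0 p(1) by (subst nm) (simp add: prime_factorization_mult)
    also have "prime_factors (p ^ multiplicity p n) = {p}"
      using k p(1) by (simp add: prime_factors_power prime_prime_factors)
    finally have ins: "insert p P = insert p (prime_factors m)"
      using n0 by simp
    have "p \<notin> prime_factors m"
      using \<open>\<not> p dvd m\<close> by auto
    then have "prime_factors m = P"
      using insert.hyps(2) ins by (metis insert_ident)
    with m0 show "m > 0 \<and> prime_factors m = P"
      by simp
  qed
  have fin: "finite F'"
    using insert.prems by (simp add: F'_def)
  have "(\<Sum>n\<in>F. 1 / real n) = (\<Sum>x\<in>g ` F. 1 / real p ^ fst x * (1 / real (snd x)))"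
    by (subst sum.reindex[OF inj], intro sum.cong refl, subst dec) simp
  also have "\<dots> \<le> (\<Sum>x\<in>{1..L} \<times> F'. 1 / real p ^ fst x * (1 / real (snd x)))"
    using gF fin by (intro sum_mono2) auto
  also have "\<dots> = (\<Sum>k=1..L. 1 / real p ^ k) * (\<Sum>m\<in>F'. 1 / real m)"
    by (simp add: sum_product sum.cartesian_product case_prod_unfold)
  also have "\<dots> \<le> 1 / (real p - 1) * (\<Prod>p\<in>P. 1 / (real p - 1))"
  proof (rule mult_mono)
    show "(\<Sum>m\<in>F'. 1 / real m) \<le> (\<Prod>p\<in>P. 1 / (real p - 1))"
      using insert.IH[OF fin _ F'] insert.prems by simp
  qed (use p sum_geometric_prime_le in \<open>auto intro: sum_nonneg\<close>)
  finally show ?case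
    using insert.hyps by simp
qed

text \<open>Group the n up to Q by their radical q, which is squarefree and at most n. Those with
  radical q contribute at most the product of 1/(p - 1) over the primes p dividing q, and this is
  the reciprocal of the totient of q.\<close>

lemma harm_le_sum_inverse_totient:
  "harm Q \<le> (\<Sum>q | q \<in> {1..Q} \<and> squarefree q. 1 / real (totient q))"
proof -
  define r where "r = (\<lambda>n::nat. \<Prod>(prime_factors n))"
  let ?T = "{q. q \<in> {1..Q} \<and> squarefree q}"
  have pr: "prime_factors (r n) = prime_factors n" for n
  proof -
    have "r n \<noteq> 0"
      by (auto simp: r_def)
    then have "p \<in> prime_factors (r n) \<longleftrightarrow> prime p \<and> p dvd r n" for p
      by (auto simp: prime_factors_dvd)
    moreover have "p dvd r n \<longleftrightarrow> p \<in> prime_factors n" if "prime p" for p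
    proof -
      have "p dvd r n \<longleftrightarrow> (\<exists>q\<in>prime_factors n. p dvd q)"
        using that unfolding r_def by (subst prime_dvd_prod_iff) auto
      also have "\<dots> \<longleftrightarrow> p \<in> prime_factors n"
        using that primes_dvd_imp_eq in_prime_factors_imp_prime by (metis dvd_refl)
      finally show ?thesis .
    qed
    ultimately show ?thesis
      using in_prime_factors_imp_prime by blast
  qed
  have sq: "squarefree (r n)" for n
    unfolding r_def by (intro squarefree_prod_coprime) (auto intro: primes_coprime squarefree_prime in_prime_factors_imp_prime)
  have le: "r n \<in> ?T" if n: "n \<in> {1..Q}" for n
  proof -
    have "r n dvd (\<Prod>p\<in>prime_factors n. p ^ multiplicity p n)"
      unfolding r_def by (intro prod_dvd_prod) (auto simp: prime_factors_multiplicity)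
    also have "\<dots> = n"
      using n by (intro prime_factorization_nat[symmetric]) auto
    finally have "r n \<le> n"
      using n by (intro dvd_imp_le) auto
    moreover have "r n \<noteq> 0"
      using sq[of n] by (intro notI) simp
    ultimately show ?thesis
      using n sq by auto
  qed
  have "harm Q = (\<Sum>n\<in>{1..Q}. 1 / real n)"
    by (simp add: harm_def inverse_eq_divide)
  also have "\<dots> = (\<Sum>q\<in>?T. \<Sum>n\<in>{n\<in>{1..Q}. r n = q}. 1 / real n)"
    using le by (subst sum.group) auto
  also have "\<dots> \<le> (\<Sum>q\<in>?T. 1 / real (totient q))"
  proof (rule sum_mono)
    fix q assume q: "q \<in> ?T"
    have "(\<Sum>n\<in>{n\<in>{1..Q}. r n = q}. 1 / real n) \<le> (\<Prod>p\<in>prime_factors q. 1 / (real p - 1))"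
      using pr by (intro sum_inverse_prime_factors_le) auto
    also have "\<dots> = 1 / real (totient q)"
    proof -
      have "real (totient q) = (\<Prod>p\<in>prime_factors q. real p - 1)"
      proof -
        have "totient q = (\<Prod>p\<in>prime_factors q. p - 1)"
          using q by (subst totient_formula1)
            (auto intro!: prod.cong simp: squarefree_factorial_semiring')
        moreover have "real (p - 1) = real p - 1" if "p \<in> prime_factors q" for p
          using prime_ge_1_nat[OF in_prime_factors_imp_prime[OF that]] by simp
        ultimately show ?thesis
          by simp
      qed
      then show ?thesis
        by (simp add: prod_dividef)
    qed
    finally show "(\<Sum>n\<in>{n\<in>{1..Q}. r n = q}. 1 / real n) \<le> 1 / real (totient q)" .
  qed
  finally show ?thesis .
qed

section \<open>Exponential sums on major arcs\<close>

text \<open>One notation serves both the primes, embedded in the integers, and the interval of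
  integers, so that products of the two sums can be treated uniformly.\<close>

definition expsum :: "int set \<Rightarrow> real \<Rightarrow> complex" where
  "expsum X \<beta> = (\<Sum>n\<in>X. e (real_of_int n * \<beta>))"

lemma continuous_on_e [continuous_intros]:
  "continuous_on T f \<Longrightarrow> continuous_on T (\<lambda>x. e (f x))"
  unfolding e_def by (intro continuous_intros)

lemma continuous_on_expsum [continuous_intros]:
  "continuous_on T f \<Longrightarrow> continuous_on T (\<lambda>x. expsum X (f x))"
  unfolding expsum_def by (intro continuous_intros)

lemma norm_expsum_le: "cmod (expsum X \<beta>) \<le> real (card X)"
  unfolding expsum_def by (rule order_trans[OF norm_sum]) simp

lemma has_integral_e_period:
  "((\<lambda>\<beta>. e (real_of_int n * \<beta>)) has_integral (if n = 0 then 1 else 0)) {a..a + 1}"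
proof (cases "n = 0")
  case True
  then show ?thesis
    using has_integral_const_real[of "1::complex" a "a + 1"] by simp
next
  case False
  define c where "c = 2 * \<i> * complex_of_real pi * of_int n"
  have c: "c \<noteq> 0"
    using False by (simp add: c_def)
  have e: "e (real_of_int n * x) = exp (c * of_real x)" for x
    by (simp add: e_def c_def mult_ac)
  have "((\<lambda>x. exp (c * of_real x) / c) has_vector_derivative exp (c * of_real x)) (at x within A)"
    for x A
    by (rule has_vector_derivative_real_field[where f = "\<lambda>z. exp (c * z) / c"])
      (use c in \<open>auto intro!: derivative_eq_intros\<close>)
  then have "((\<lambda>x. exp (c * of_real x)) has_integral
      (exp (c * of_real (a + 1)) / c - exp (c * of_real a) / c)) {a..a + 1}"
    by (intro fundamental_theorem_of_calculus) auto
  moreover have "exp (c * of_real (a + 1)) = exp (c * of_real a)"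
    using e_add[of "real_of_int n * a" "real_of_int n"] e[of "a + 1"] e[of a]
    by (simp add: ring_distribs)
  ultimately show ?thesis
    using False by (simp add: e)
qed

text \<open>Only the diagonal m = n survives integration over a period. Equal sets give Parseval's
  identity; different sets give the cross term of the variance.\<close>

lemma has_integral_expsum_mult_cnj:
  assumes "finite X" "finite Y"
  shows "((\<lambda>\<beta>. expsum X \<beta> * cnj (expsum Y \<beta>)) has_integral of_nat (card (X \<inter> Y))) {a..a + 1}"
proof -
  have "((\<lambda>\<beta>. \<Sum>m\<in>X. \<Sum>n\<in>Y. e (real_of_int (m - n) * \<beta>)) has_integral
      (\<Sum>m\<in>X. \<Sum>n\<in>Y. if m - n = 0 then 1 else 0)) {a..a + 1}"
    by (intro has_integral_sum assms has_integral_e_period)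
  moreover have "(\<Sum>m\<in>X. \<Sum>n\<in>Y. e (real_of_int (m - n) * \<beta>)) = expsum X \<beta> * cnj (expsum Y \<beta>)" for \<beta>
    by (simp add: expsum_def sum_product cnj_e left_diff_distrib flip: e_add)
  moreover have "(\<Sum>m\<in>X. \<Sum>n\<in>Y. if m - n = 0 then 1 else 0) = (of_nat (card (X \<inter> Y)) :: complex)"
    using assms by (simp add: sum.If_cases Int_def flip: of_nat_sum sum.inter_filter)
  ultimately show ?thesis
    by simp
qed

lemma integral_norm_expsum_period:
  assumes "finite X"
  shows "integral {a..a + 1} (\<lambda>\<beta>. (cmod (expsum X \<beta>))\<^sup>2) = real (card X)"
proof -
  have "((\<lambda>\<beta>. Re (expsum X \<beta> * cnj (expsum X \<beta>))) has_integral Re (of_nat (card X))) {a..a + 1}"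
    using has_integral_Re[OF has_integral_expsum_mult_cnj[OF assms assms]] by simp
  then show ?thesis
    by (simp add: complex_mult_cnj cmod_power2 integral_unique)
qed

section \<open>A large sieve bound for the central arc\<close>

text \<open>Summing the shifts by a/q attaches a Ramanujan sum to each n in X. This is one common
  sign s, so the total has the absolute value of the unshifted sum, and Cauchy-Schwarz over the
  \<open>totient q\<close> shifts finishes.\<close>

lemma norm_expsum_le_sum_totatives:
  assumes "finite X" "squarefree q" "\<forall>n\<in>X. coprime n (int q)"
  shows "(cmod (expsum X \<beta>))\<^sup>2 / real (totient q)
    \<le> (\<Sum>a\<in>totatives q. (cmod (expsum X (\<beta> + real a / real q)))\<^sup>2)"
proof -
  obtain s where s: "s \<in> {1, -1}" "\<And>n. coprime n (int q) \<Longrightarrow> ramanujan_sum q n = s"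
    using ramanujan_sum_squarefree[OF assms(2)] by blast
  have q: "totient q > 0"
    using assms(2) by (cases "q = 0") auto
  have "(\<Sum>a\<in>totatives q. expsum X (\<beta> + real a / real q))
      = (\<Sum>n\<in>X. e (real_of_int n * \<beta>) * ramanujan_sum q n)"
    unfolding expsum_def ramanujan_sum_def sum_distrib_left
    by (subst sum.swap) (simp add: ring_distribs mult_ac flip: e_add)
  also have "\<dots> = s * expsum X \<beta>"
    using assms(3) s(2) by (simp add: expsum_def sum_distrib_left mult.commute)
  finally have "cmod (expsum X \<beta>) = cmod (\<Sum>a\<in>totatives q. expsum X (\<beta> + real a / real q))"
    using s(1) by (auto simp: norm_mult)
  also have "\<dots> \<le> (\<Sum>a\<in>totatives q. cmod (expsum X (\<beta> + real a / real q)))"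
    by (rule norm_sum)
  finally have "(cmod (expsum X \<beta>))\<^sup>2 \<le> (\<Sum>a\<in>totatives q. cmod (expsum X (\<beta> + real a / real q)))\<^sup>2"
    by (intro power_mono) auto
  also have "\<dots> \<le> (\<Sum>a\<in>totatives q. (cmod (expsum X (\<beta> + real a / real q)))\<^sup>2) * real (card (totatives q))"
    by (rule sum_squared_le_sum_of_squares)
  finally show ?thesis
    using q by (simp add: divide_le_eq totient_def)
qed

text \<open>Over the common denominator q * q', which is at most Q^2, the numerator is an integer;
  it is nonzero because two equal reduced fractions have the same denominator and numerator.\<close>

lemma farey_distance:
  assumes "a \<in> totatives q" "a' \<in> totatives q'" "q \<le> Q" "q' \<le> Q" "(q, a) \<noteq> (q', a')"
  shows "1 / real Q ^ 2 \<le> \<bar>real a / real q - real a' / real q'\<bar>"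
proof -
  have pos: "q > 0" "q' > 0" "a > 0" "a' > 0"
    using assms(1,2) by (auto simp: in_totatives_iff)
  have cop: "coprime a q" "coprime a' q'"
    using assms(1,2) by (auto simp: in_totatives_iff)
  have ne: "a * q' \<noteq> a' * q"
  proof
    assume eq: "a * q' = a' * q"
    have "q dvd q'"
      using eq cop(1) by (metis coprime_commute coprime_dvd_mult_right_iff dvd_triv_right)
    moreover have "q' dvd q"
      using eq cop(2) by (metis coprime_commute coprime_dvd_mult_right_iff dvd_triv_right)
    ultimately have "q = q'"
      by (rule dvd_antisym)
    with eq pos assms(5) show False
      by simp
  qed
  have "1 / real Q ^ 2 \<le> 1 / (real q * real q')"
    using pos assms(3,4) unfolding power2_eq_square
    by (intro divide_left_mono mult_mono mult_pos_pos) auto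
  also have "\<dots> \<le> \<bar>real_of_int (int a * int q' - int a' * int q)\<bar> / (real q * real q')"
  proof (rule divide_right_mono)
    have "int a * int q' - int a' * int q \<noteq> 0"
      using ne by (metis eq_iff_diff_eq_0 of_nat_eq_iff of_nat_mult)
    then show "1 \<le> \<bar>real_of_int (int a * int q' - int a' * int q)\<bar>"
      by linarith
  qed auto
  also have "\<dots> = \<bar>real a / real q - real a' / real q'\<bar>"
    using pos by (simp add: diff_frac_eq abs_mult)
  finally show ?thesis .
qed

text \<open>The arcs of radius \<open>d\<close> around the Farey fractions of order \<open>Q\<close> are pairwise disjoint and lie
  in a single period.\<close>
lemma expsum_major_arc_le:
  assumes fin: "finite X" and cop: "\<And>n q. n \<in> X \<Longrightarrow> 1 \<le> q \<Longrightarrow> q \<le> Q \<Longrightarrow> coprime n (int q)"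
    and d: "d \<ge> 0" "2 * d * real Q ^ 2 < 1" and Q: "Q \<ge> 1"
  shows "ln (real Q + 1) * integral {-d..d} (\<lambda>\<beta>. (cmod (expsum X \<beta>))\<^sup>2) \<le> real (card X)"
proof -
  define f where "f = (\<lambda>\<beta>. (cmod (expsum X \<beta>))\<^sup>2)"
  define T where "T = {q. q \<in> {1..Q} \<and> squarefree q}"
  define I where "I = Sigma T totatives"
  define arc where "arc = (\<lambda>(q, a). {real a / real q - d..real a / real q + d})"
  have finI: "finite I"
    by (auto simp: I_def T_def)
  have cont: "continuous_on A f" for A
    unfolding f_def by (intro continuous_intros)
  have int: "f integrable_on {u..v}" for u v
    by (rule integrable_continuous_real[OF cont])
  have int': "(\<lambda>\<beta>. f (\<beta> + c)) integrable_on {u..v}" for u v c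
    unfolding f_def by (intro integrable_continuous_real continuous_intros)
  have Q2: "2 * d < 1 / real Q ^ 2"
    using d(2) Q by (simp add: field_simps)
  have disj: "arc i \<inter> arc j = {}" if ij: "i \<in> I" "j \<in> I" "i \<noteq> j" for i j
  proof (rule ccontr)
    obtain q a q' a' where i: "i = (q, a)" and j: "j = (q', a')"
      by fastforce
    assume "arc i \<inter> arc j \<noteq> {}"
    then obtain x where "x \<in> arc i" "x \<in> arc j"
      by blast
    then have "\<bar>real a / real q - real a' / real q'\<bar> \<le> 2 * d"
      by (auto simp: arc_def i j)
    moreover have "1 / real Q ^ 2 \<le> \<bar>real a / real q - real a' / real q'\<bar>"
      using ij by (intro farey_distance) (auto simp: i j I_def T_def)
    ultimately show False
      using Q2 by linarith
  qed
  \<comment> \<open>The period starts at d because the fractions run from 1/Q up to and including 1: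
    the arc around 1 ends at 1 + d, and 2 * d < 1/Q keeps the others to the right of d.\<close>
  have sub: "arc i \<subseteq> {d..d + 1}" if i: "i \<in> I" for i
  proof -
    obtain q a where qa: "i = (q, a)"
      by fastforce
    have q: "1 \<le> q" "q \<le> Q" "1 \<le> a" "a \<le> q"
      using i by (auto simp: qa I_def T_def in_totatives_iff)
    have "2 * d < 1 / real Q ^ 2"
      by (rule Q2)
    also have "\<dots> \<le> 1 / real Q"
      using Q by (intro divide_left_mono) (auto simp: power2_eq_square)
    also have "\<dots> \<le> real a / real q"
      using q by (intro frac_le) auto
    finally have "2 * d \<le> real a / real q"
      by simp
    moreover have "real a / real q \<le> 1"
      using q by simp
    ultimately show ?thesis
      by (auto simp: arc_def qa)
  qed
  have shift: "integral (arc (q, a)) f = integral {-d..d} (\<lambda>\<beta>. f (\<beta> + real a / real q))" for q a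
    using integral_shift_real_ivl[of "real a / real q - d" "real a / real q" "real a / real q + d" f]
    by (simp add: arc_def)
  have union: "(f has_integral (\<Sum>i\<in>I. integral (arc i) f)) (\<Union>i\<in>I. arc i)"
  proof (rule has_integral_UN[OF finI])
    show "(f has_integral integral (arc i) f) (arc i)" for i
      by (cases i) (auto simp: arc_def intro: integrable_integral int)
    show "pairwise (\<lambda>i j. negligible (arc i \<inter> arc j)) I"
      using disj by (auto simp: pairwise_def)
  qed
  \<comment> \<open>The harmonic number mediates: it lies below the totient sum and above
    \<open>ln (Q + 1)\<close>.\<close>
  have "harm Q * integral {-d..d} f \<le> (\<Sum>q\<in>T. 1 / real (totient q)) * integral {-d..d} f"
    unfolding T_def by (intro mult_right_mono harm_le_sum_inverse_totient integral_nonneg int) (auto simp: f_def)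
  also have "\<dots> = integral {-d..d} (\<lambda>\<beta>. \<Sum>q\<in>T. f \<beta> / real (totient q))"
    using int by (subst integral_sum) (auto simp: T_def sum_distrib_right)
  also have "\<dots> \<le> integral {-d..d} (\<lambda>\<beta>. \<Sum>q\<in>T. \<Sum>a\<in>totatives q. f (\<beta> + real a / real q))"
  proof (rule integral_le)
    show "(\<Sum>q\<in>T. f \<beta> / real (totient q)) \<le> (\<Sum>q\<in>T. \<Sum>a\<in>totatives q. f (\<beta> + real a / real q))"
      for \<beta>
      unfolding f_def
      by (intro sum_mono norm_expsum_le_sum_totatives fin) (auto simp: T_def intro: cop)
  qed (auto intro!: integrable_sum int int' integrable_on_divide simp: T_def)
  also have "\<dots> = (\<Sum>q\<in>T. \<Sum>a\<in>totatives q. integral (arc (q, a)) f)"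
    by (simp add: integral_sum integrable_sum int' T_def shift)
  also have "\<dots> = (\<Sum>i\<in>I. integral (arc i) f)"
    unfolding I_def by (subst sum.Sigma) (auto simp: T_def case_prod_unfold)
  also have "\<dots> = integral (\<Union>i\<in>I. arc i) f"
    by (rule integral_unique[OF union, symmetric])
  also have "\<dots> \<le> integral {d..d + 1} f"
  proof (rule integral_subset_le)
    show "f integrable_on (\<Union>i\<in>I. arc i)"
      by (rule has_integral_integrable[OF union])
  qed (use sub int in \<open>auto simp: f_def\<close>)
  also have "\<dots> = real (card X)"
    unfolding f_def by (rule integral_norm_expsum_period[OF fin])
  finally have "harm Q * integral {-d..d} f \<le> real (card X)" .
  moreover have "ln (real Q + 1) * integral {-d..d} f \<le> harm Q * integral {-d..d} f"
    by (intro mult_right_mono ln_le_harm integral_nonneg int) (auto simp: f_def)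
  ultimately show ?thesis
    by (simp add: f_def)
qed

section \<open>The exponential sum over an interval, away from the integers\<close>

text \<open>For a geometric sum the numerator is at most 2 in absolute value, while the denominator
  has absolute value 2 |sin(pi \<beta>)|. The squared bound has an explicit antiderivative in terms
  of the cotangent.\<close>

lemma norm_expsum_interval_le:
  assumes "sin (pi * \<beta>) \<noteq> 0"
  shows "(cmod (expsum {u..v} \<beta>))\<^sup>2 \<le> inverse ((sin (pi * \<beta>))\<^sup>2)"
proof -
  have ne: "e \<beta> \<noteq> 1"
  proof
    assume "e \<beta> = 1"
    then obtain k :: int where "\<beta> = of_int k"
      by (auto simp: e_eq_1_iff elim: Ints_cases)
    with assms show False
      using sin_zero_iff_int2 by (metis mult.commute)
  qed
  have norm_sub: "cmod (1 - e \<beta>) = 2 * \<bar>sin (pi * \<beta>)\<bar>"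
  proof -
    have "(cmod (1 - e \<beta>))\<^sup>2 = (1 - cos (2 * (pi * \<beta>)))\<^sup>2 + (sin (2 * (pi * \<beta>)))\<^sup>2"
      by (simp add: cmod_power2 e_eq_cis mult_ac)
    also have "\<dots> = 2 - 2 * cos (2 * (pi * \<beta>))"
      using sin_cos_squared_add[of "2 * (pi * \<beta>)"] by (simp add: power2_eq_square algebra_simps)
    also have "\<dots> = (2 * \<bar>sin (pi * \<beta>)\<bar>)\<^sup>2"
      by (simp add: cos_double_sin power_mult_distrib)
    finally show ?thesis
      by (subst (asm) power2_eq_iff_nonneg) auto
  qed
  have "cmod (1 - e \<beta>) * cmod (expsum {u..v} \<beta>) \<le> 2"
  proof (cases "u \<le> v")
    case True
    define m where "m = nat (v - u + 1)"
    have "expsum {u..v} \<beta> = (\<Sum>j<m. e (real_of_int (u + int j) * \<beta>))"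
      unfolding expsum_def m_def
      by (rule sum.reindex_bij_witness[of _ "\<lambda>j. u + int j" "\<lambda>n. nat (n - u)"]) auto
    also have "\<dots> = e (real_of_int u * \<beta>) * (\<Sum>j<m. e \<beta> ^ j)"
      by (simp add: sum_distrib_left e_power ring_distribs flip: e_add)
    also have "(\<Sum>j<m. e \<beta> ^ j) = (1 - e \<beta> ^ m) / (1 - e \<beta>)"
      using ne by (simp add: sum_gp_strict)
    finally have "cmod (1 - e \<beta>) * cmod (expsum {u..v} \<beta>) = cmod (1 - e \<beta> ^ m)"
      using ne by (simp add: norm_mult norm_divide)
    also have "\<dots> \<le> 2"
      using norm_triangle_ineq4[of 1 "e \<beta> ^ m"] by (simp add: norm_power)
    finally show ?thesis .
  qed (simp add: expsum_def)
  then have "\<bar>sin (pi * \<beta>)\<bar> * cmod (expsum {u..v} \<beta>) \<le> 1"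
    by (simp add: norm_sub)
  then have "cmod (expsum {u..v} \<beta>) \<le> inverse \<bar>sin (pi * \<beta>)\<bar>"
    using assms by (simp add: field_simps)
  then have "(cmod (expsum {u..v} \<beta>))\<^sup>2 \<le> (inverse \<bar>sin (pi * \<beta>)\<bar>)\<^sup>2"
    by (intro power_mono) auto
  then show ?thesis
    by (simp add: power_inverse)
qed

text \<open>The difference sin y - y cos y vanishes at 0 and has derivative y sin y. It serves to
  bound cot y by 1/y.\<close>

lemma mult_cos_le_sin:
  fixes y :: real
  assumes "0 \<le> y" "y \<le> pi"
  shows "y * cos y \<le> sin y"
proof -
  have "sin 0 - 0 * cos 0 \<le> sin y - y * cos y"
  proof (rule DERIV_nonneg_imp_nondecreasing[OF assms(1)])
    fix x assume x: "0 \<le> x" "x \<le> y"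
    have "((\<lambda>y. sin y - y * cos y) has_real_derivative x * sin x) (at x)"
      by (auto intro!: derivative_eq_intros)
    moreover have "x * sin x \<ge> 0"
      using x assms by (intro mult_nonneg_nonneg sin_ge_zero) auto
    ultimately show "\<exists>D. ((\<lambda>y. sin y - y * cos y) has_real_derivative D) (at x) \<and> 0 \<le> D"
      by blast
  qed
  then show ?thesis
    by simp
qed

text \<open>Integrating the sine bound gives equal contributions from both endpoints, in total 2
  cot(pi d)/pi, which is at most 2/(pi^2 d).\<close>

lemma integral_norm_expsum_interval_tail_le:
  assumes "0 < d" "d \<le> 1 / 4"
  shows "integral {d..1 - d} (\<lambda>\<beta>. (cmod (expsum {u..v} \<beta>))\<^sup>2) \<le> 1 / d"
proof -
  have sin_pos: "sin (pi * x) > 0" if "x \<in> {d..1 - d}" for x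
    using that assms by (intro sin_gt_zero) (auto simp: mult_less_cancel_left)
  have hi: "((\<lambda>x. inverse ((sin (pi * x))\<^sup>2)) has_integral
      (- cot (pi * (1 - d)) / pi - (- cot (pi * d) / pi))) {d..1 - d}"
  proof (rule fundamental_theorem_of_calculus)
    show "d \<le> 1 - d"
      using assms by simp
    fix x assume "x \<in> {d..1 - d}"
    then have "sin (pi * x) \<noteq> 0"
      using sin_pos by force
    then have "((\<lambda>x. cot (pi * x)) has_real_derivative - inverse ((sin (pi * x))\<^sup>2) * pi) (at x within {d..1 - d})"
      by (intro DERIV_chain2[OF DERIV_cot]) (auto intro!: derivative_eq_intros)
    then have "((\<lambda>x. - cot (pi * x) / pi) has_real_derivative
        - (- inverse ((sin (pi * x))\<^sup>2) * pi) / pi) (at x within {d..1 - d})"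
      by (intro DERIV_cdivide DERIV_minus)
    then show "((\<lambda>x. - cot (pi * x) / pi) has_vector_derivative inverse ((sin (pi * x))\<^sup>2)) (at x within {d..1 - d})"
      by (simp add: has_real_derivative_iff_has_vector_derivative)
  qed
  have "integral {d..1 - d} (\<lambda>\<beta>. (cmod (expsum {u..v} \<beta>))\<^sup>2)
      \<le> integral {d..1 - d} (\<lambda>x. inverse ((sin (pi * x))\<^sup>2))"
  proof (rule integral_le)
    show "(\<lambda>\<beta>. (cmod (expsum {u..v} \<beta>))\<^sup>2) integrable_on {d..1 - d}"
      by (intro integrable_continuous_real continuous_intros)
    show "(\<lambda>x. inverse ((sin (pi * x))\<^sup>2)) integrable_on {d..1 - d}"
      by (rule has_integral_integrable[OF hi])
    show "(cmod (expsum {u..v} x))\<^sup>2 \<le> inverse ((sin (pi * x))\<^sup>2)" if "x \<in> {d..1 - d}" for x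
      using sin_pos[OF that] by (intro norm_expsum_interval_le) simp
  qed
  also have "\<dots> = 2 * cot (pi * d) / pi"
  proof -
    have "cot (pi * (1 - d)) = - cot (pi * d)"
      by (simp add: cot_def right_diff_distrib sin_diff cos_diff)
    then show ?thesis
      using integral_unique[OF hi] by simp
  qed
  also have "\<dots> \<le> 2 * (1 / (pi * d)) / pi"
  proof (intro divide_right_mono mult_left_mono)
    have "pi * d * cos (pi * d) \<le> sin (pi * d)"
      using assms by (intro mult_cos_le_sin) (auto simp: mult_le_cancel_left2)
    then show "cot (pi * d) \<le> 1 / (pi * d)"
      using assms sin_pos[of d] by (simp add: cot_def field_simps)
  qed auto
  also have "\<dots> = 2 / pi\<^sup>2 * (1 / d)"
    by (simp add: power2_eq_square)
  also have "\<dots> \<le> 1 * (1 / d)"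
  proof (rule mult_right_mono)
    have "2 * 2 \<le> pi * pi"
      using pi_ge_two by (intro mult_mono) auto
    then show "2 / pi\<^sup>2 \<le> 1"
      by (simp add: power2_eq_square)
  qed (use assms in auto)
  finally show ?thesis
    by simp
qed

section \<open>Expanding the mean square on the central arc\<close>

text \<open>The cross term over a full period is exactly \<open>card X\<close>, so only its part
  outside [-d, d] has to be estimated. There the weight lam balances the trivial bound for the sum
  over X against the good bound for the sum over the interval.\<close>

lemma major_arc_variance_le:
  assumes fin: "finite X" and X: "X \<subseteq> {u..v}"
    and d: "0 < d" "d \<le> 1 / 4" and x: "x \<ge> 0" and lam: "lam > 0"
  shows "integral {-d..d} (\<lambda>\<beta>. (cmod (expsum X \<beta> - complex_of_real x * expsum {u..v} \<beta>))\<^sup>2)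
    \<le> integral {-d..d} (\<lambda>\<beta>. (cmod (expsum X \<beta>))\<^sup>2) - 2 * x * real (card X)
      + x\<^sup>2 * real (card {u..v}) + x * (lam * real (card X) + 1 / (lam * d))"
proof -
  let ?S = "expsum X" and ?T = "expsum {u..v}"
  define s t c where "s = (\<lambda>\<beta>. (cmod (?S \<beta>))\<^sup>2)" and "t = (\<lambda>\<beta>. (cmod (?T \<beta>))\<^sup>2)"
    and "c = (\<lambda>\<beta>. Re (?S \<beta> * cnj (?T \<beta>)))"
  have ints: "s integrable_on {a..b}" "t integrable_on {a..b}" "c integrable_on {a..b}" for a b
    unfolding s_def t_def c_def by (intro integrable_continuous_real continuous_intros)+
  have nn: "s \<beta> \<ge> 0" "t \<beta> \<ge> 0" for \<beta>
    by (simp_all add: s_def t_def)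
  have expand: "(cmod (?S \<beta> - complex_of_real x * ?T \<beta>))\<^sup>2 = s \<beta> - 2 * x * c \<beta> + x\<^sup>2 * t \<beta>" for \<beta>
    unfolding s_def t_def c_def cmod_power2 by (simp add: power2_eq_square algebra_simps)
  \<comment> \<open>In the period starting at -d, the complement of the central arc is
    [d, 1 - d].\<close>
  have full: "integral {-d..d} g + integral {d..1 - d} g = integral {-d..-d + 1} g"
    if "\<And>a b. g integrable_on {a..b}" for g :: "real \<Rightarrow> real"
    using d that Henstock_Kurzweil_Integration.integral_combine[of "- d" d "- d + 1" g]
    by (simp add: add.commute)
  have c_full: "integral {-d..-d + 1} c = real (card X)"
  proof -
    have "(c has_integral Re (of_nat (card (X \<inter> {u..v})))) {-d..-d + 1}"
      unfolding c_def by (intro has_integral_Re has_integral_expsum_mult_cnj fin) auto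
    then show ?thesis
      using X by (simp add: integral_unique Int_absorb2)
  qed
  have t_full: "integral {-d..d} t \<le> real (card {u..v})"
    using full[OF ints(2)] integral_norm_expsum_period[of "{u..v}" "-d"]
      integral_nonneg[OF ints(2)[of d "1 - d"]] nn unfolding t_def by simp
  have s_full: "integral {d..1 - d} s \<le> real (card X)"
    using full[OF ints(1)] integral_norm_expsum_period[OF fin, of "-d"]
      integral_nonneg[OF ints(1)[of "-d" d]] nn unfolding s_def by simp
  have "2 * integral {d..1 - d} c = integral {d..1 - d} (\<lambda>\<beta>. 2 * c \<beta>)"
    by simp
  also have "\<dots> \<le> integral {d..1 - d} (\<lambda>\<beta>. lam * s \<beta> + 1 / lam * t \<beta>)"
  proof (rule integral_le)
    fix \<beta>
    have "c \<beta> \<le> cmod (?S \<beta>) * cmod (?T \<beta>)"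
      unfolding c_def using complex_Re_le_cmod[of "?S \<beta> * cnj (?T \<beta>)"] by (simp add: norm_mult)
    \<comment> \<open>Weighted AM-GM by completing the square.\<close>
    moreover have "lam * s \<beta> + 1 / lam * t \<beta> - 2 * (cmod (?S \<beta>) * cmod (?T \<beta>))
        = (lam * cmod (?S \<beta>) - cmod (?T \<beta>))\<^sup>2 / lam"
      using lam by (simp add: s_def t_def power2_eq_square field_simps)
    moreover have "\<dots> \<ge> 0"
      using lam by simp
    ultimately show "2 * c \<beta> \<le> lam * s \<beta> + 1 / lam * t \<beta>"
      by linarith
  qed (intro integrable_add integrable_on_mult_right ints)+
  also have "\<dots> = lam * integral {d..1 - d} s + 1 / lam * integral {d..1 - d} t"
    by (subst integral_add) (auto intro!: integrable_on_mult_right integrable_on_divide ints simp del: times_divide_eq_left)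
  also have "\<dots> \<le> lam * real (card X) + 1 / lam * (1 / d)"
    using s_full integral_norm_expsum_interval_tail_le[OF d] lam
    by (intro add_mono mult_left_mono) (auto simp: t_def)
  finally have tail: "2 * integral {d..1 - d} c \<le> lam * real (card X) + 1 / (lam * d)"
    by simp
  have "integral {-d..d} (\<lambda>\<beta>. (cmod (?S \<beta> - complex_of_real x * ?T \<beta>))\<^sup>2)
      = integral {-d..d} s - 2 * x * integral {-d..d} c + x\<^sup>2 * integral {-d..d} t"
    unfolding expand
    by (subst integral_add integral_diff; (intro integrable_add integrable_diff integrable_on_mult_right ints)?)+
      simp
  also have "2 * x * integral {-d..d} c = 2 * x * real (card X) - x * (2 * integral {d..1 - d} c)"
    using full[OF ints(3)] c_full by (simp add: algebra_simps flip: distrib_left)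
  also have "integral {-d..d} s - (2 * x * real (card X) - x * (2 * integral {d..1 - d} c))
        + x\<^sup>2 * integral {-d..d} t
      \<le> integral {-d..d} s - (2 * x * real (card X) - x * (lam * real (card X) + 1 / (lam * d)))
        + x\<^sup>2 * real (card {u..v})"
    using tail t_full x by (intro add_mono diff_left_mono diff_mono mult_left_mono) auto
  finally show ?thesis
    by (simp add: s_def algebra_simps)
qed

section \<open>Primes in an interval\<close>

lemma ints_between_eq: "ints_between M N = {\<lceil>M + 1\<rceil>..\<lfloor>M + N\<rfloor>}"
  unfolding ints_between_def by (auto simp del: ceiling_add_one simp: ceiling_le_iff le_floor_iff)

text \<open>The closed interval has length N - 1, so no rounding error appears; this makes the last
  term of the expanded square at most Z^2/N exactly.\<close>

lemma card_ints_between_le: "N \<ge> 0 \<Longrightarrow> real (card (ints_between M N)) \<le> N"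
  unfolding ints_between_eq by (simp del: ceiling_add_one) linarith

lemma int_primes_between_subset: "int ` primes_between M N \<subseteq> ints_between M N"
  by (auto simp: primes_between_def ints_between_def)

lemma card_int_primes_between: "card (int ` primes_between M N) = Z M N"
  unfolding Z_def by (rule card_image) simp

lemma Z_le: "N \<ge> 0 \<Longrightarrow> real (Z M N) \<le> N"
  using card_mono[OF finite_ints_between int_primes_between_subset[of M N]]
    card_ints_between_le[of N M] by (simp add: card_int_primes_between)

lemma S_eq_expsum: "S M N \<beta> = expsum (int ` primes_between M N) \<beta>"
  unfolding S_def expsum_def by (subst sum.reindex) simp_all

definition deviation :: "real \<Rightarrow> real \<Rightarrow> real \<Rightarrow> real" where
  "deviation M N \<beta> = (cmod (S M N \<beta>
     - complex_of_real (real (Z M N) / N) * (\<Sum>n\<in>ints_between M N. e (real_of_int n * \<beta>))))\<^sup>2"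

lemma deviation_eq:
  "deviation M N \<beta> = (cmod (expsum (int ` primes_between M N) \<beta>
     - complex_of_real (real (Z M N) / N) * expsum (ints_between M N) \<beta>))\<^sup>2"
  by (simp add: deviation_def S_eq_expsum expsum_def)

lemma deviation_integrable: "deviation M N integrable_on {a..b}"
  unfolding deviation_eq by (intro integrable_continuous_real continuous_intros)

lemma deviation_nonneg: "deviation M N \<beta> \<ge> 0"
  by (simp add: deviation_def)

lemma integral_deviation_mono:
  "d \<le> d' \<Longrightarrow> integral {-d..d} (deviation M N) \<le> integral {-d'..d'} (deviation M N)"
  by (intro integral_subset_le deviation_integrable) (auto simp: deviation_nonneg)

text \<open>Separates the small primes, collected in b, from the difference that is really
  estimated.\<close>

lemma norm_diff_power2_le: "(cmod (a + b - c))\<^sup>2 \<le> 2 * (cmod (a - c))\<^sup>2 + 2 * (cmod b)\<^sup>2"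
proof -
  have "(cmod (a + b - c))\<^sup>2 \<le> (cmod (a - c) + cmod b)\<^sup>2"
    using norm_triangle_ineq[of "a - c" b] by (intro power_mono) (auto simp: algebra_simps)
  also have "\<dots> \<le> 2 * (cmod (a - c))\<^sup>2 + 2 * (cmod b)\<^sup>2"
    using zero_le_power2[of "cmod (a - c) - cmod b"] by (simp add: power2_eq_square algebra_simps)
  finally show ?thesis .
qed

text \<open>Both sums have modulus at most Z after scaling, so the integrand is at most 4 Z^2 on an
  arc of length 2 d. This settles bounded N.\<close>

lemma integral_deviation_trivial:
  assumes "d \<ge> 0" "N > 0"
  shows "integral {-d..d} (deviation M N) \<le> 8 * d * (real (Z M N))\<^sup>2"
proof -
  have le: "deviation M N \<beta> \<le> (2 * real (Z M N))\<^sup>2" for \<beta>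
  proof -
    have "real (Z M N) / N * cmod (expsum (ints_between M N) \<beta>) \<le> real (Z M N) / N * N"
      using norm_expsum_le[of "ints_between M N" \<beta>] card_ints_between_le[of N M] assms
      by (intro mult_left_mono) auto
    then have "cmod (complex_of_real (real (Z M N) / N) * expsum (ints_between M N) \<beta>) \<le> real (Z M N)"
      using assms by (simp add: norm_mult norm_divide)
    moreover have "cmod (expsum (int ` primes_between M N) \<beta>) \<le> real (Z M N)"
      using norm_expsum_le[of "int ` primes_between M N" \<beta>] by (simp add: card_int_primes_between)
    ultimately have "cmod (expsum (int ` primes_between M N) \<beta>
        - complex_of_real (real (Z M N) / N) * expsum (ints_between M N) \<beta>) \<le> 2 * real (Z M N)"
      using norm_triangle_ineq4[of "expsum (int ` primes_between M N) \<beta>"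
          "complex_of_real (real (Z M N) / N) * expsum (ints_between M N) \<beta>"] by linarith
    then show ?thesis
      unfolding deviation_eq by (intro power_mono) auto
  qed
  have "integral {-d..d} (deviation M N) \<le> integral {-d..d} (\<lambda>_. (2 * real (Z M N))\<^sup>2)"
    by (intro integral_le deviation_integrable le) auto
  also have "\<dots> = 8 * d * (real (Z M N))\<^sup>2"
    using assms by (simp add: power_mult_distrib)
  finally show ?thesis .
qed

text \<open>Only the primes exceeding \<open>Q\<close> are coprime to all moduli up to \<open>Q\<close>; the others are
  few enough for the trivial bound.\<close>
lemma integral_deviation_le:
  fixes M N d lam :: real and Q :: nat
  assumes N: "N > 0" and Q: "Q \<ge> 1" and d: "0 < d" "d \<le> 1 / 4" "2 * d * real Q ^ 2 < 1"
    and lam: "lam > 0"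
  defines "z \<equiv> real (Z M N)"
  defines "x \<equiv> z / N"
  shows "integral {-d..d} (deviation M N)
    \<le> 2 * (z / ln (real Q + 1) - x * z + 2 * x * real Q + x * (lam * z + 1 / (lam * d))) + 2"
proof -
  define P where "P = int ` primes_between M N"
  define X where "X = {n \<in> P. n > int Q}"
  define u v where "u = \<lceil>M + 1\<rceil>" and "v = \<lfloor>M + N\<rfloor>"
  have I: "ints_between M N = {u..v}"
    unfolding u_def v_def by (rule ints_between_eq)
  have finP: "finite P" and finX: "finite X"
    by (simp_all add: P_def X_def)
  have x: "x \<ge> 0"
    using N by (simp add: x_def z_def)
  have z: "z \<ge> 0"
    by (simp add: z_def)
  have PX: "P - X \<subseteq> {1..int Q}"
    by (auto simp: P_def X_def primes_between_def prime_ge_Suc_0_nat)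
  have card_small: "card (P - X) \<le> Q"
    using card_mono[OF _ PX] by simp
  have card_z: "real (card P) = z"
    by (simp add: P_def z_def card_int_primes_between)
  have cardX_le: "real (card X) \<le> z"
    using card_mono[OF finP, of X] card_z by (simp add: X_def)
  have "X \<subseteq> P"
    by (auto simp: X_def)
  then have "card P = card X + card (P - X)"
    using finP finX by (simp add: card_Diff_subset card_mono)
  then have cardX_ge: "z - real Q \<le> real (card X)"
    using card_small card_z by linarith
  have P_split: "expsum P \<beta> = expsum X \<beta> + expsum (P - X) \<beta>" for \<beta>
    unfolding expsum_def using finP \<open>X \<subseteq> P\<close> by (metis sum.subset_diff add.commute)
  define f where "f = (\<lambda>\<beta>. (cmod (expsum X \<beta> - complex_of_real x * expsum {u..v} \<beta>))\<^sup>2)"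
  define g where "g = (\<lambda>\<beta>. (cmod (expsum (P - X) \<beta>))\<^sup>2)"
  have int: "f integrable_on {a..b}" "g integrable_on {a..b}" for a b
    unfolding f_def g_def by (intro integrable_continuous_real continuous_intros)+
  \<comment> \<open>The factor 2 is harmless, since the main terms cancel already within the bound
    for f.\<close>
  have "integral {-d..d} (deviation M N) \<le> integral {-d..d} (\<lambda>\<beta>. 2 * f \<beta> + 2 * g \<beta>)"
  proof (rule integral_le)
    show "deviation M N \<beta> \<le> 2 * f \<beta> + 2 * g \<beta>" for \<beta>
      using norm_diff_power2_le[of "expsum X \<beta>" "expsum (P - X) \<beta>" "complex_of_real x * expsum {u..v} \<beta>"]
      unfolding deviation_eq I P_def[symmetric] z_def[symmetric] x_def[symmetric] P_split f_def g_def .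
  qed (intro deviation_integrable integrable_add integrable_on_mult_right int)+
  also have "\<dots> = 2 * integral {-d..d} f + 2 * integral {-d..d} g"
    by (subst integral_add) (auto intro!: integrable_on_mult_right int)
  also have "integral {-d..d} g \<le> 1"
  proof -
    have "integral {-d..d} g \<le> integral {-d..d} (\<lambda>_. (real Q)\<^sup>2)"
    proof (rule integral_le)
      show "g \<beta> \<le> (real Q)\<^sup>2" for \<beta>
        unfolding g_def using norm_expsum_le[of "P - X" \<beta>] card_small by (intro power_mono) auto
    qed (use int in auto)
    also have "\<dots> = 2 * d * real Q ^ 2"
      using d by simp
    finally show ?thesis
      using d by linarith
  qed
  also have "integral {-d..d} f
      \<le> z / ln (real Q + 1) - x * z + 2 * x * real Q + x * (lam * z + 1 / (lam * d))"
  proof -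
    have "integral {-d..d} (\<lambda>\<beta>. (cmod (expsum X \<beta>))\<^sup>2) \<le> z / ln (real Q + 1)"
    proof -
      have "coprime n (int q)" if nq: "n \<in> X" "1 \<le> q" "q \<le> Q" for n q
      proof -
        obtain p where p: "n = int p" "prime p" "p > Q"
          using nq(1) by (auto simp: X_def P_def primes_between_def)
        have "\<not> p dvd q"
          using p nq by (auto dest: dvd_imp_le)
        then show ?thesis
          using p by (auto intro: prime_imp_coprime)
      qed
      then have "ln (real Q + 1) * integral {-d..d} (\<lambda>\<beta>. (cmod (expsum X \<beta>))\<^sup>2) \<le> real (card X)"
        using d Q by (intro expsum_major_arc_le finX) auto
      moreover have "ln (real Q + 1) > 0"
        using Q by (intro ln_gt_zero) auto
      ultimately show ?thesis
        using cardX_le by (simp add: pos_le_divide_eq mult.commute)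
    qed
    moreover have "integral {-d..d} f
        \<le> integral {-d..d} (\<lambda>\<beta>. (cmod (expsum X \<beta>))\<^sup>2) - 2 * x * real (card X)
          + x\<^sup>2 * real (card {u..v}) + x * (lam * real (card X) + 1 / (lam * d))"
      unfolding f_def
    proof (rule major_arc_variance_le[OF finX _ d(1,2) x lam])
      show "X \<subseteq> {u..v}"
        using \<open>X \<subseteq> P\<close> int_primes_between_subset[of M N] by (simp add: P_def I)
    qed
    \<comment> \<open>Replacing \<open>card X\<close> by z in the cross term costs 2 x Q. Together
      with the last square the main part becomes -2 x z + x z = -x z.\<close>
    moreover have "2 * x * (z - real Q) \<le> 2 * x * real (card X)"
      using x cardX_ge by (intro mult_left_mono) auto
    moreover have "x\<^sup>2 * real (card {u..v}) \<le> x\<^sup>2 * N"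
      using card_ints_between_le[of N M] N unfolding I by (intro mult_left_mono) auto
    moreover have "x\<^sup>2 * N = x * z"
      using N by (simp add: x_def power2_eq_square)
    moreover have "x * (lam * real (card X) + 1 / (lam * d)) \<le> x * (lam * z + 1 / (lam * d))"
      using x lam cardX_le by (intro mult_left_mono add_mono) auto
    ultimately show ?thesis
      by (simp add: algebra_simps)
  qed
  finally show ?thesis
    by simp
qed

section \<open>Choice of parameters for large N\<close>

lemma integral_deviation_large:
  fixes B C :: real
  assumes C: "C > 0" and B: "B \<ge> 4"
  shows "\<forall>\<^sub>F N in at_top. \<forall>M. real (Z M N) \<ge> 2 * N / (ln N + C * ln (ln N)) \<longrightarrow>
    integral {- (ln N powr B / N)..ln N powr B / N} (deviation M N)
      \<le> (8 * B + 4 * C + 32) * (real (Z M N) * ln (ln N) / (ln N)\<^sup>2)"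
proof -
  have "\<forall>\<^sub>F N in at_top. N \<ge> (3 :: real)"
    by (rule eventually_ge_at_top)
  moreover have "\<forall>\<^sub>F N :: real in at_top. ln N powr B / N \<le> 1 / 4"
    using B by real_asymp
  moreover have "\<forall>\<^sub>F N :: real in at_top. 2 * ((B + 3) * ln (ln N)) \<le> ln N"
    using B by real_asymp
  moreover have "\<forall>\<^sub>F N :: real in at_top. C * ln (ln N) \<le> ln N"
    using C by real_asymp
  moreover have "\<forall>\<^sub>F N :: real in at_top. ln (ln N) \<ge> 1"
    by real_asymp
  moreover have "\<forall>\<^sub>F N :: real in at_top. ln N ^ 4 \<le> N"
    by real_asymp
  ultimately show ?thesis
  proof eventually_elim
    case (elim N)
    define L l d where "L = ln N" and "l = ln L" and "d = L powr B / N"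
    have N: "N \<ge> 3" and d4: "d \<le> 1 / 4" and cl: "2 * ((B + 3) * l) \<le> L" and Cl: "C * l \<le> L"
      and l1: "l \<ge> 1" and L4: "L ^ 4 \<le> N"
      using elim by (simp_all add: L_def l_def d_def)
    have L1: "L \<ge> 1"
    proof -
      have "L \<ge> 2 * ((B + 3) * l)"
        by (rule cl)
      moreover have "1 * 1 \<le> (B + 3) * l"
        using B l1 by (intro mult_mono) auto
      ultimately show ?thesis
        by linarith
    qed
    have d0: "d > 0"
      using L1 N by (simp add: d_def)
    \<comment> \<open>This gives 2 d Q^2 at most 1/2, as disjoint arcs require, while d at most 1/4
      ensures that Q is at least 1.\<close>
    define Q where "Q = nat \<lfloor>sqrt (1 / (4 * d))\<rfloor>"
    have "1 \<le> sqrt (1 / (4 * d))"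
      using d0 d4 by simp
    then have Q1: "Q \<ge> 1"
      unfolding Q_def by linarith
    have Q_le: "real Q \<le> sqrt (1 / (4 * d))"
      unfolding Q_def using \<open>1 \<le> sqrt (1 / (4 * d))\<close> by linarith
    have Q_ge: "sqrt (1 / (4 * d)) \<le> real Q + 1"
      unfolding Q_def by linarith
    have "real Q ^ 2 \<le> (sqrt (1 / (4 * d)))\<^sup>2"
      using Q_le by (intro power_mono) auto
    also have "\<dots> = 1 / (4 * d)"
      using d0 by simp
    finally have Q_sq: "2 * d * real Q ^ 2 < 1"
      using d0 by (simp add: field_simps)
    \<comment> \<open>Here 1/(4 d) = N/(4 L^B); the 3 in B + 3 absorbs ln 4, as l is at least
      1.\<close>
    have "(L - (B + 3) * l) / 2 \<le> ln (sqrt (1 / (4 * d)))"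
    proof -
      have "ln (sqrt (1 / (4 * d))) = (L - B * l - ln 4) / 2"
        using d0 N L1 unfolding d_def
        by (simp add: ln_sqrt ln_div ln_mult ln_powr L_def l_def)
      moreover have "ln 4 \<le> (3 :: real)"
        using ln_le_minus_one[of 4] by simp
      then have "ln 4 \<le> 3 * l"
        using l1 by linarith
      ultimately show ?thesis
        by (simp add: algebra_simps)
    qed
    also have "\<dots> \<le> ln (real Q + 1)"
      using Q_ge d0 by (subst ln_le_cancel_iff) auto
    finally have lnQ: "(L - (B + 3) * l) / 2 \<le> ln (real Q + 1)" .
    show ?case
    proof (intro allI impI)
      fix M assume hyp: "real (Z M N) \<ge> 2 * N / (ln N + C * ln (ln N))"
      define z x where "z = real (Z M N)" and "x = z / N"
      have z0: "z \<ge> 0" and zN: "z \<le> N"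
        using Z_le[of N M] N by (auto simp: z_def)
      have x0: "x \<ge> 0" and x1: "x \<le> 1"
        using z0 zN N by (auto simp: x_def)
      have w: "C * l \<ge> 0"
        using C l1 by simp
      have hyp': "z \<ge> 2 * N / (L + C * l)"
        using hyp by (simp add: z_def L_def l_def)
      \<comment> \<open>Linearises 2/(L - c) around 2/L, which is legitimate because 2 c is at most
        L.\<close>
      have 1: "z / ln (real Q + 1) \<le> z * (2 / L + 4 * (B + 3) * l / L\<^sup>2)"
      proof -
        define c where "c = (B + 3) * l"
        have c: "0 \<le> c" "2 * c \<le> L"
          using cl l1 B by (auto simp: c_def)
        have "2 * c * c \<le> L * c"
          using c by (intro mult_right_mono) auto
        then have key: "L\<^sup>2 \<le> (L + 2 * c) * (L - c)"
          by (simp add: power2_eq_square algebra_simps)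
        have "1 / ln (real Q + 1) \<le> 1 / ((L - c) / 2)"
          using lnQ c L1 unfolding c_def[symmetric] by (intro divide_left_mono mult_pos_pos) (use Q1 in auto)
        also have "\<dots> \<le> 2 * (L + 2 * c) / L\<^sup>2"
          using key c L1 by (simp add: divide_le_eq pos_le_divide_eq algebra_simps)
        also have "\<dots> = 2 / L + 4 * c / L\<^sup>2"
          using L1 by (simp add: field_simps power2_eq_square)
        finally have "z * (1 / ln (real Q + 1)) \<le> z * (2 / L + 4 * c / L\<^sup>2)"
          using z0 by (rule mult_left_mono)
        then show ?thesis
          by (simp only: c_def mult.assoc mult_1_right times_divide_eq_right)
      qed
      \<comment> \<open>The hypothesis reads x >= 2/(L + C l), and (L - C l)(L + C l) <= L^2 turns
        this into a linear lower bound.\<close>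
      have 2: "x * z \<ge> z * (2 / L - 2 * C * l / L\<^sup>2)"
      proof -
        have "2 / L - 2 * C * l / L\<^sup>2 = 2 * (L - C * l) / L\<^sup>2"
          using L1 by (simp add: field_simps power2_eq_square)
        also have "\<dots> \<le> 2 / (L + C * l)"
        proof -
          have "(L - C * l) * (L + C * l) = L\<^sup>2 - (C * l)\<^sup>2"
            by (simp add: power2_eq_square algebra_simps)
          also have "\<dots> \<le> L\<^sup>2"
            by simp
          finally have "2 * (L - C * l) * (L + C * l) \<le> 2 * L\<^sup>2"
            by linarith
          then show ?thesis
            using L1 w by (simp add: pos_divide_le_eq pos_le_divide_eq)
        qed
        also have "\<dots> \<le> x"
          using hyp' N L1 w by (simp add: x_def field_simps)
        finally have "(2 / L - 2 * C * l / L\<^sup>2) * z \<le> x * z"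
          using z0 by (rule mult_right_mono)
        then show ?thesis
          by (simp only: mult.commute)
      qed
      have 3: "2 * x * real Q \<le> z / L\<^sup>2"
      proof -
        have "1 \<le> L powr B"
          using L1 B by (simp add: ge_one_powr_ge_zero)
        then have "N / 4 / L powr B \<le> N / 4 / 1"
          using N by (intro divide_left_mono) auto
        then have "1 / (4 * d) \<le> (sqrt N / 2)\<^sup>2"
          using N by (simp add: d_def power_divide)
        then have "sqrt (1 / (4 * d)) \<le> sqrt N / 2"
          using N by (intro real_le_lsqrt) auto
        then have "real Q \<le> sqrt N / 2"
          using Q_le by linarith
        then have "2 * x * real Q \<le> 2 * x * (sqrt N / 2)"
          using x0 by (intro mult_left_mono) auto
        also have "\<dots> = z / sqrt N"
          using N by (simp add: x_def real_div_sqrt field_simps)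
        also have "L\<^sup>2 \<le> sqrt N"
          using L4 by (intro real_le_rsqrt) simp
        then have "z / sqrt N \<le> z / L\<^sup>2"
          using z0 L1 N by (intro divide_left_mono mult_pos_pos) auto
        finally show ?thesis .
      qed
      \<comment> \<open>With lam = 1/L^2 the tail of the interval sum contributes z L^2/L^B; this is
        where B >= 4 is needed.\<close>
      have 4: "x * (1 / L\<^sup>2 * z + 1 / (1 / L\<^sup>2 * d)) \<le> 2 * (z / L\<^sup>2)"
      proof -
        have "L powr 4 = L\<^sup>2 * L\<^sup>2"
          using L1 by (simp add: powr_numeral flip: power_add)
        then have "L\<^sup>2 / L powr 4 = 1 / L\<^sup>2"
          using L1 by (metis nonzero_divide_mult_cancel_left not_one_le_zero zero_eq_power2)
        moreover have "L\<^sup>2 / L powr B \<le> L\<^sup>2 / L powr 4"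
          using L1 B by (intro divide_left_mono powr_mono mult_pos_pos) auto
        ultimately have "z * (L\<^sup>2 / L powr B) \<le> z * (1 / L\<^sup>2)"
          using z0 by (intro mult_left_mono) auto
        moreover have "x * (1 / (1 / L\<^sup>2 * d)) = z * (L\<^sup>2 / L powr B)"
          using N L1 by (simp add: x_def d_def)
        ultimately have "x * (1 / (1 / L\<^sup>2 * d)) \<le> z / L\<^sup>2"
          by simp
        moreover have "x * (1 / L\<^sup>2 * z) \<le> 1 * (1 / L\<^sup>2 * z)"
          using x1 z0 by (intro mult_right_mono) auto
        then have "x * (1 / L\<^sup>2 * z) \<le> z / L\<^sup>2"
          by simp
        ultimately show ?thesis
          unfolding distrib_left by linarith
      qed
      \<comment> \<open>Lets the additive constant 2 be absorbed: the hypothesis forces z >= N/L >=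
        L^3.\<close>
      have 5: "1 \<le> z / L\<^sup>2"
      proof -
        have "N / L = 2 * N / (L + L)"
          by simp
        also have "\<dots> \<le> 2 * N / (L + C * l)"
          using N L1 w Cl by (intro divide_left_mono mult_pos_pos) auto
        also have "\<dots> \<le> z"
          by (rule hyp')
        finally have "N \<le> z * L"
          using L1 by (simp add: divide_le_eq)
        have "L ^ 3 * 1 \<le> L ^ 3 * L"
          using L1 by (intro mult_left_mono) auto
        also have "\<dots> \<le> z * L"
          using L4 \<open>N \<le> z * L\<close> by (simp add: power_numeral_reduce)
        finally have "L\<^sup>2 * L \<le> z * L"
          by (simp add: power_numeral_reduce)
        then show ?thesis
          using L1 by simp
      qed
      have "integral {-d..d} (deviation M N)
          \<le> 2 * (z / ln (real Q + 1) - x * z + 2 * x * real Q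
            + x * (1 / L\<^sup>2 * z + 1 / (1 / L\<^sup>2 * d))) + 2"
        unfolding x_def z_def using N Q1 d0 d4 Q_sq L1 by (intro integral_deviation_le) auto
      also have "\<dots> \<le> 2 * (z * (2 / L + 4 * (B + 3) * l / L\<^sup>2) - z * (2 / L - 2 * C * l / L\<^sup>2)
          + z / L\<^sup>2 + 2 * (z / L\<^sup>2)) + 2 * (z / L\<^sup>2)"
        by (intro add_mono diff_mono mult_left_mono[where c = "2 :: real"] 1 2 3 4) (use 5 in auto)
      \<comment> \<open>The terms 2 z/L cancel. Doubling 4 (B + 3) + 2 C gives 8 B + 4 C + 24, and
        the copies of z/L^2 number 2 (1 + 2) + 2 = 8.\<close>
      also have "\<dots> = (8 * B + 4 * C + 24) * (z * l / L\<^sup>2) + 8 * (z / L\<^sup>2)"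
        using L1 by (simp add: field_simps power2_eq_square)
      also have "\<dots> \<le> (8 * B + 4 * C + 24) * (z * l / L\<^sup>2) + 8 * (z * l / L\<^sup>2)"
        using l1 z0 L1 by (intro add_left_mono mult_left_mono divide_right_mono) (auto simp: mult_le_cancel_left1)
      also have "\<dots> = (8 * B + 4 * C + 32) * (z * l / L\<^sup>2)"
        by (simp add: algebra_simps)
      finally show "integral {- (ln N powr B / N)..ln N powr B / N} (deviation M N)
          \<le> (8 * B + 4 * C + 32) * (real (Z M N) * ln (ln N) / (ln N)\<^sup>2)"
        by (simp add: d_def L_def l_def z_def)
    qed
  qed
qed

section \<open>The estimate for all N\<close>

theorem corollary1p2:
  fixes A C :: real
  assumes "C > 0" and "A \<ge> 2"
  shows "\<exists>K::real. \<forall>(M::real) (N::real). N \<ge> 3 \<longrightarrow>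
    real (Z M N) \<ge> 2 * N / (ln N + C * ln (ln N)) \<longrightarrow>
    integral {- ((ln N powr A) / N) .. (ln N powr A) / N}
      (\<lambda>\<beta>. (cmod (S M N \<beta>
              - complex_of_real (real (Z M N) / N) * (\<Sum>n\<in>ints_between M N. e (real_of_int n * \<beta>))))\<^sup>2)
    \<le> K * (real (Z M N) * ln (ln N) / (ln N)\<^sup>2)"
proof -
  \<comment> \<open>Enlarging the exponent only enlarges the integral of a nonnegative function,
    since ln N > 1.\<close>
  define B where "B = max A 4"
  obtain N0 where large: "\<And>M N. N \<ge> N0 \<Longrightarrow> real (Z M N) \<ge> 2 * N / (ln N + C * ln (ln N)) \<Longrightarrow>
    integral {- (ln N powr B / N)..ln N powr B / N} (deviation M N)
      \<le> (8 * B + 4 * C + 32) * (real (Z M N) * ln (ln N) / (ln N)\<^sup>2)"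
    using integral_deviation_large[OF assms(1), of B] unfolding eventually_at_top_linorder
    by (auto simp: B_def)
  \<comment> \<open>The second entry covers 3 <= N < N0: the trivial bound loses (ln N)^(A + 2), at
    most its value at N0, and lacks the factor ln ln N, which is at least ln ln 3 > 0.\<close>
  define K where "K = max (8 * B + 4 * C + 32) (8 * ln N0 powr (A + 2) / ln (ln 3))"
  have "0 \<le> 8 * B + 4 * C + 32"
    using assms by (simp add: B_def)
  then have K0: "K \<ge> 0"
    unfolding K_def by (rule max.coboundedI1)
  have ln3: "ln 3 > (1 :: real)"
    using e_less_272 ln_less_cancel_iff[of "exp 1" 3] by simp
  show ?thesis
  proof (intro exI[of _ K] allI impI)
    fix M N :: real
    assume N: "N \<ge> 3" and hyp: "real (Z M N) \<ge> 2 * N / (ln N + C * ln (ln N))"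
    have L: "ln 3 \<le> ln N"
      using N by simp
    then have L1: "ln N > 1"
      using ln3 by linarith
    have l: "0 < ln (ln 3 :: real)" "ln (ln 3) \<le> ln (ln N)"
      using L ln3 by auto
    then have l0: "0 < ln (ln N)"
      by linarith
    have "integral {- ((ln N powr A) / N)..(ln N powr A) / N} (deviation M N)
        \<le> K * (real (Z M N) * ln (ln N) / (ln N)\<^sup>2)"
    proof (cases "N \<ge> N0")
      case True
      have "integral {- ((ln N powr A) / N)..(ln N powr A) / N} (deviation M N)
          \<le> integral {- ((ln N powr B) / N)..(ln N powr B) / N} (deviation M N)"
        using L1 N by (intro integral_deviation_mono divide_right_mono powr_mono) (auto simp: B_def)
      also have "\<dots> \<le> (8 * B + 4 * C + 32) * (real (Z M N) * ln (ln N) / (ln N)\<^sup>2)"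
        by (rule large[OF True hyp])
      also have "\<dots> \<le> K * (real (Z M N) * ln (ln N) / (ln N)\<^sup>2)"
        using l0 by (intro mult_right_mono divide_nonneg_nonneg mult_nonneg_nonneg) (auto simp: K_def)
      finally show ?thesis .
    next
      case False
      have "integral {- ((ln N powr A) / N)..(ln N powr A) / N} (deviation M N)
          \<le> 8 * (ln N powr A / N) * (real (Z M N))\<^sup>2"
        using N L1 by (intro integral_deviation_trivial) auto
      \<comment> \<open>One factor Z is traded for N, cancelling the N in the radius.\<close>
      also have "\<dots> \<le> 8 * (ln N powr A / N) * (real (Z M N) * N)"
        using N Z_le[of N M] unfolding power2_eq_square by (intro mult_left_mono) auto
      also have "\<dots> = 8 * ln N powr A * real (Z M N)"
        using N by simp
      also have "\<dots> = 8 * ln N powr (A + 2) * (real (Z M N) / (ln N)\<^sup>2)"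
        using L1 by (simp add: powr_add)
      also have "\<dots> \<le> 8 * ln N0 powr (A + 2) * (real (Z M N) / (ln N)\<^sup>2)"
        using False N L1 assms by (intro mult_right_mono mult_left_mono powr_mono2) auto
      also have "\<dots> = 8 * ln N0 powr (A + 2) / ln (ln 3) * (ln (ln 3) * (real (Z M N) / (ln N)\<^sup>2))"
        using l by simp
      also have "\<dots> \<le> K * (ln (ln N) * (real (Z M N) / (ln N)\<^sup>2))"
        using l l0 K0 by (intro mult_mono mult_nonneg_nonneg) (auto simp: K_def)
      finally show ?thesis
        by (simp add: mult_ac)
    qed
    then show "integral {- ((ln N powr A) / N) .. (ln N powr A) / N}
      (\<lambda>\<beta>. (cmod (S M N \<beta>
              - complex_of_real (real (Z M N) / N) * (\<Sum>n\<in>ints_between M N. e (real_of_int n * \<beta>))))\<^sup>2)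
      \<le> K * (real (Z M N) * ln (ln N) / (ln N)\<^sup>2)"
      by (simp add: deviation_def[abs_def])
  qed
qed

end
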